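(* For all integers $n\ge k\ge 0$, the rescaled mixed moment $\tilde\sigma^{AW,H}_{n,k}(a_1,a_2,a_3,a_4;q)$ is symmetric in $a_1,a_2,a_3,a_4$, i.e. invariant under every permutation of $a_1,a_2,a_3,a_4$. Equivalently, the mixed moment $\sigma^{AW,H}_{n,k}(a,b,c,d;q)$ of Askey--Wilson polynomials relative to continuous $q$-Hermite polynomials (and also the coefficient $\nu^{AW,H}_{n,k}(a,b,c,d;q)$) is symmetric in $a,b,c,d$.
   Context: Notation: $(z;q)_n=\prod_{i=0}^{n-1}(1-zq^i)$, $(z_1,\dots,z_r;q)_n=\prod_s(z_s;q)_n$, and ${}_r\phi_s(\alpha_1,\dots,\alpha_r;\beta_1,\dots,\beta_s;q,z)=\sum_{k\ge0}\frac{(\alpha_1,\dots,\alpha_r;q)_k}{(q,\beta_1,\dots,\beta_s;q)_k}\big((-1)^kq^{\binom k2}\big)^{1+s-r}z^k$. Let $x=\cos\theta$ and $\mathbf i=\sqrt{-1}$; $a,b,c,d,q$ are indeterminates. The monic Askey--Wilson polynomials are \[ p_n(x;a,b,c,d|q)=\frac{(ab,ac,ad;q)_n}{2^na^n(abcdq^{n-1};q)_n}\;{}_4\phi_3\!\left(\begin{matrix}q^{-n},\,abcdq^{n-1},\,ae^{\mathbf i\theta},\,ae^{-\mathbf i\theta}\\ ab,\,ac,\,ad\end{matrix};q,q\right). \] The monic continuous $q$-Hermite polynomials are \[ H_n(x|q)=\frac{e^{\mathbf in\theta}}{2^n}\;{}_2\phi_0\!\left(\begin{matrix}q^{-n},0\\-\end{matrix};q,q^ne^{-2\mathbf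 i\theta}\right). \] Define $\sigma^{AW,H}_{n,k}$ and $\nu^{AW,H}_{n,k}$ by \[ H_n(x|q)=\sum_{k=0}^n\sigma^{AW,H}_{n,k}(a,b,c,d;q)\,p_k(x;a,b,c,d|q),\qquad p_n(x;a,b,c,d|q)=\sum_{k=0}^n\nu^{AW,H}_{n,k}(a,b,c,d;q)\,H_k(x|q), \] and the rescaled mixed moments by \[ \tilde\sigma^{AW,H}_{n,k}(a,b,c,d;q)=\frac{2^{n-k}}{\mathbf i^{\,n-k}}\,\sigma^{AW,H}_{n,k}(\mathbf ia,\mathbf ib,\mathbf ic,\mathbf id;q). \] The parameters $a_1,a_2,a_3,a_4$ are used in place of $a,b,c,d$. *)

theory Defs
  imports
    Complex_Main
    "HOL-Library.Groups_Big_Fun"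
    "HOL-Computational_Algebra.Polynomial"
    "HOL-Combinatorics.Permutations"
begin

definition qpoch :: "'f::field_char_0 \<Rightarrow> 'f \<Rightarrow> nat \<Rightarrow> 'f" where
  "qpoch z q n = (\<Prod>i<n. 1 - z * q ^ i)"

definition qpochs :: "'f::field_char_0 list \<Rightarrow> 'f \<Rightarrow> nat \<Rightarrow> 'f" where
  "qpochs zs q n = (\<Prod>z\<leftarrow>zs. qpoch z q n)"

(* The formal sum has its intended meaning for terminating series, the only ones used here. *)
definition basic_hypergeometric ::
  "'f::field_char_0 list \<Rightarrow> 'f list \<Rightarrow> 'f \<Rightarrow> 'f \<Rightarrow> 'f" where
  "basic_hypergeometric as bs q z =
     Sum_any (\<lambda>k. qpochs as q k / qpochs (q # bs) q k
       * ((-1) ^ k * q ^ (k choose 2)) powi (1 + int (length bs) - int (length as)) * z ^ k)"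

(* z stands for exp (i theta), so that x = cos theta becomes (z + inverse z) / 2.
   For 'f = complex every nonzero z is of this form. The definite description is justified
   by laurent_poly_unique and, for the two families, by poly_askey_wilson and
   poly_q_hermite below. *)
definition poly_in_x :: "('f::field_char_0 \<Rightarrow> 'f) \<Rightarrow> 'f poly" where
  "poly_in_x f = (THE P. \<forall>z. z \<noteq> 0 \<longrightarrow> poly P ((z + inverse z) / 2) = f z)"

definition askey_wilson_val ::
  "nat \<Rightarrow> 'f::field_char_0 \<Rightarrow> 'f \<Rightarrow> 'f \<Rightarrow> 'f \<Rightarrow> 'f \<Rightarrow> 'f \<Rightarrow> 'f" where
  "askey_wilson_val n a b c d q z =
     qpochs [a * b, a * c, a * d] q n
       / (2 ^ n * a ^ n * qpoch (a * b * c * d * q powi (int n - 1)) q n)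
     * basic_hypergeometric
         [q powi (- int n), a * b * c * d * q powi (int n - 1), a * z, a * inverse z]
         [a * b, a * c, a * d] q q"

definition askey_wilson ::
  "nat \<Rightarrow> 'f::field_char_0 \<Rightarrow> 'f \<Rightarrow> 'f \<Rightarrow> 'f \<Rightarrow> 'f \<Rightarrow> 'f poly" where
  "askey_wilson n a b c d q = poly_in_x (askey_wilson_val n a b c d q)"

definition q_hermite_val :: "nat \<Rightarrow> 'f::field_char_0 \<Rightarrow> 'f \<Rightarrow> 'f" where
  "q_hermite_val n q z =
     z ^ n / 2 ^ n * basic_hypergeometric [q powi (- int n), 0] [] q (q ^ n * z powi (-2))"

definition q_hermite :: "nat \<Rightarrow> 'f::field_char_0 \<Rightarrow> 'f poly" where
  "q_hermite n q = poly_in_x (q_hermite_val n q)"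

(* The coefficients c(k) in P(n) = sum of c(k) Q(k) over k = 0..n, extended by 0 to k > n;
   see connection_coeffs_ex1 for existence and uniqueness. *)
definition connection_coeffs ::
  "(nat \<Rightarrow> 'f::field_char_0 poly) \<Rightarrow> (nat \<Rightarrow> 'f poly) \<Rightarrow> nat \<Rightarrow> nat \<Rightarrow> 'f" where
  "connection_coeffs P Q n =
     (THE s. (\<forall>k>n. s k = 0) \<and> P n = (\<Sum>k\<le>n. smult (s k) (Q k)))"

definition sigma_AW_H ::
  "nat \<Rightarrow> nat \<Rightarrow> 'f::field_char_0 \<Rightarrow> 'f \<Rightarrow> 'f \<Rightarrow> 'f \<Rightarrow> 'f \<Rightarrow> 'f" where
  "sigma_AW_H n k a b c d q =
     connection_coeffs (\<lambda>m. q_hermite m q) (\<lambda>m. askey_wilson m a b c d q) n k"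

definition nu_AW_H ::
  "nat \<Rightarrow> nat \<Rightarrow> 'f::field_char_0 \<Rightarrow> 'f \<Rightarrow> 'f \<Rightarrow> 'f \<Rightarrow> 'f \<Rightarrow> 'f" where
  "nu_AW_H n k a b c d q =
     connection_coeffs (\<lambda>m. askey_wilson m a b c d q) (\<lambda>m. q_hermite m q) n k"

(* ii is a square root of -1 in 'f; this is imposed where the definition is used. *)
definition sigma_tilde_AW_H ::
  "'f::field_char_0 \<Rightarrow> nat \<Rightarrow> nat \<Rightarrow> 'f \<Rightarrow> 'f \<Rightarrow> 'f \<Rightarrow> 'f \<Rightarrow> 'f \<Rightarrow> 'f" where
  "sigma_tilde_AW_H ii n k a b c d q =
     2 ^ (n - k) / ii ^ (n - k) * sigma_AW_H n k (ii * a) (ii * b) (ii * c) (ii * d) q"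

(* Replaces "a, b, c, d, q are indeterminates": no denominator occurring in the formulas above,
   for any order of the parameters and any degree, vanishes. Indeterminates, i.e. the
   generators of a field of rational functions, satisfy this. *)
definition AW_generic :: "'f::field_char_0 \<Rightarrow> 'f \<Rightarrow> 'f \<Rightarrow> 'f \<Rightarrow> 'f \<Rightarrow> bool" where
  "AW_generic a b c d q \<longleftrightarrow>
     q \<noteq> 0 \<and> (\<forall>m\<ge>1. q ^ m \<noteq> 1) \<and>
     a \<noteq> 0 \<and> b \<noteq> 0 \<and> c \<noteq> 0 \<and> d \<noteq> 0 \<and>
     (\<forall>m. a * b * q ^ m \<noteq> 1 \<and> a * c * q ^ m \<noteq> 1 \<and> a * d * q ^ m \<noteq> 1 \<and>
          b * c * q ^ m \<noteq> 1 \<and> b * d * q ^ m \<noteq> 1 \<and> c * d * q ^ m \<noteq> 1 \<and>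
          a * b * c * d * q ^ m \<noteq> 1)"


subsection \<open>Well-definedness\<close>

lemma laurent_poly_unique:
  fixes P Q :: "'f::field_char_0 poly"
  assumes "\<And>z. z \<noteq> 0 \<Longrightarrow> poly P ((z + inverse z) / 2) = poly Q ((z + inverse z) / 2)"
  shows "P = Q"
proof (rule ccontr)
  assume "P \<noteq> Q"
  define R where "R = {x. poly (P - Q) x = 0}"
  have finR: "finite R"
    unfolding R_def using \<open>P \<noteq> Q\<close> by (intro poly_roots_finite) simp
  have "finite {z. poly [:1, -2 * x, 1:] z = 0}" for x :: 'f
    by (intro poly_roots_finite) simp
  then have "finite (\<Union>x\<in>R. {z. poly [:1, -2 * x, 1:] z = 0})"
    using finR by blast
  moreover have "UNIV - {0} \<subseteq> (\<Union>x\<in>R. {z. poly [:1, -2 * x, 1:] z = 0})"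
  proof
    fix z :: 'f assume "z \<in> UNIV - {0}"
    then have z: "z \<noteq> 0" by simp
    have "(z + inverse z) / 2 \<in> R"
      using assms[OF z] by (simp add: R_def)
    moreover have "poly [:1, -2 * ((z + inverse z) / 2), 1:] z = 0"
      using z by (simp add: field_simps)
    ultimately show "z \<in> (\<Union>x\<in>R. {z. poly [:1, -2 * x, 1:] z = 0})"
      by blast
  qed
  ultimately have "finite (UNIV - {0::'f})"
    using finite_subset by blast
  then show False
    using infinite_UNIV_char_0[where 'a = 'f] by simp
qed

lemma poly_in_x_eqI:
  assumes "\<And>z. z \<noteq> 0 \<Longrightarrow> poly P ((z + inverse z) / 2) = f z"
  shows "poly_in_x f = P"
  unfolding poly_in_x_def
proof (rule the_equality)
  show "\<forall>z. z \<noteq> 0 \<longrightarrow> poly P ((z + inverse z) / 2) = f z"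
    using assms by simp
next
  fix P' assume "\<forall>z. z \<noteq> 0 \<longrightarrow> poly P' ((z + inverse z) / 2) = f z"
  then show "P' = P"
    using assms by (intro laurent_poly_unique) simp
qed

lemma qpoch_0 [simp]: "qpoch z q 0 = 1"
  by (simp add: qpoch_def)

lemma qpoch_Suc [simp]: "qpoch z q (Suc n) = qpoch z q n * (1 - z * q ^ n)"
  by (simp add: qpoch_def)

lemma qpoch_nz: "(\<And>m. z * q ^ m \<noteq> 1) \<Longrightarrow> qpoch z q n \<noteq> 0"
  by (induction n) auto

lemma qpoch_q_nz: "(\<And>m. m \<ge> 1 \<Longrightarrow> q ^ m \<noteq> 1) \<Longrightarrow> qpoch q q n \<noteq> 0"
  by (rule qpoch_nz) (metis One_nat_def Suc_le_mono le0 power_Suc)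

lemma qpoch_terminates:
  fixes q :: "'f::field_char_0"
  assumes "q \<noteq> 0" "n < k"
  shows "qpoch (q powi (- int n)) q k = 0"
  unfolding qpoch_def
  by (rule prod_zero) (use assms in \<open>auto simp: power_int_minus intro!: bexI[of _ n]\<close>)

lemma qpoch_neg:
  fixes q :: "'f::field_char_0"
  assumes "q \<noteq> 0" "k \<le> n"
  shows "(-1) ^ k * qpoch (q powi (- int n)) q k * q ^ (n * k)
         = q ^ (k choose 2) * (\<Prod>i<k. 1 - q ^ (n - i))"
  using assms(2)
proof (induction k)
  case 0
  then show ?case by (simp add: numeral_2_eq_2)
next
  case (Suc k)
  have eq: "(-1) * (1 - q powi (- int n) * q ^ k) * q ^ n = q ^ k * (1 - q ^ (n - k))"
    using assms(1) Suc.prems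
    by (simp add: power_int_minus field_simps flip: power_add)
  have ch: "Suc k choose 2 = k + (k choose 2)"
    by (simp add: numeral_2_eq_2)
  have "(-1) ^ Suc k * qpoch (q powi (- int n)) q (Suc k) * q ^ (n * Suc k)
      = ((-1) ^ k * qpoch (q powi (- int n)) q k * q ^ (n * k))
        * ((-1) * (1 - q powi (- int n) * q ^ k) * q ^ n)"
    by (simp add: power_add algebra_simps)
  also have "\<dots> = (q ^ (k choose 2) * (\<Prod>i<k. 1 - q ^ (n - i))) * (q ^ k * (1 - q ^ (n - k)))"
    using Suc.IH Suc.prems eq by simp
  also have "\<dots> = q ^ (Suc k choose 2) * (\<Prod>i<Suc k. 1 - q ^ (n - i))"
    by (simp add: ch power_add)
  finally show ?case .
qed

lemma qpoch_split:
  assumes "k \<le> n"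
  shows "qpoch q q n = qpoch q q (n - k) * (\<Prod>i<k. 1 - q ^ (n - i))"
  using assms
proof (induction k)
  case (Suc k)
  then have "n - k = Suc (n - Suc k)" by simp
  then have "qpoch q q (n - k) = qpoch q q (n - Suc k) * (1 - q ^ (n - k))"
    by (metis power_Suc qpoch_Suc)
  then show ?case using Suc by simp
qed simp

lemma Sum_any_terminating:
  fixes n :: nat
  assumes "\<And>k. n < k \<Longrightarrow> g k = 0"
  shows "Sum_any g = (\<Sum>k\<le>n. g k)"
  using assms by (intro Sum_any.expand_superset) (auto simp: not_le[symmetric])

lemma monic_addI:
  fixes A B :: "'f::field_char_0 poly"
  assumes "degree A = n" "lead_coeff A = 1" "\<And>i. i \<ge> n \<Longrightarrow> coeff B i = 0"
  shows "degree (B + A) = n \<and> lead_coeff (B + A) = 1"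
proof -
  have "coeff (B + A) n = 1" using assms by auto
  moreover have "degree (B + A) \<le> n"
    by (rule degree_le) (use assms in \<open>auto simp: coeff_eq_0\<close>)
  ultimately have "degree (B + A) = n"
    by (intro antisym le_degree) auto
  with \<open>coeff (B + A) n = 1\<close> show ?thesis by simp
qed

definition AW_basis :: "'f::field_char_0 \<Rightarrow> 'f \<Rightarrow> nat \<Rightarrow> 'f poly" where
  "AW_basis a q k = (\<Prod>i<k. [:1 + a\<^sup>2 * (q ^ i)\<^sup>2, -2 * a * q ^ i:])"

lemma poly_AW_basis:
  assumes "z \<noteq> 0"
  shows "poly (AW_basis a q k) ((z + inverse z) / 2) = qpoch (a * z) q k * qpoch (a * inverse z) q k"
  unfolding AW_basis_def qpoch_def poly_prod prod.distrib[symmetric]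
  using assms by (intro prod.cong) (simp_all add: field_simps power2_eq_square)

lemma AW_basis_degree:
  assumes "a \<noteq> 0" "q \<noteq> 0"
  shows "degree (AW_basis a q k) = k \<and> lead_coeff (AW_basis a q k) = (-2 * a) ^ k * q ^ (k choose 2)"
proof (induction k)
  case 0
  then show ?case by (simp add: AW_basis_def numeral_2_eq_2)
next
  case (Suc k)
  have st: "AW_basis a q (Suc k) = AW_basis a q k * [:1 + a\<^sup>2 * (q ^ k)\<^sup>2, -2 * a * q ^ k:]"
    by (simp add: AW_basis_def)
  have nz: "AW_basis a q k \<noteq> 0"
    using Suc assms by (metis leading_coeff_0_iff mult_eq_0_iff neg_equal_0_iff_equal
        power_not_zero zero_neq_numeral)
  have ch: "Suc k choose 2 = k + (k choose 2)"
    by (simp add: numeral_2_eq_2)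
  have "degree (AW_basis a q (Suc k)) = Suc k"
    unfolding st using Suc assms nz by (subst degree_mult_eq) auto
  moreover have "lead_coeff (AW_basis a q (Suc k)) = (-2 * a) ^ Suc k * q ^ (Suc k choose 2)"
  proof -
    have "lead_coeff [:1 + a\<^sup>2 * (q ^ k)\<^sup>2, -2 * a * q ^ k:] = -2 * a * q ^ k"
      using assms by simp
    then show ?thesis
      unfolding st lead_coeff_mult using conjunct2[OF Suc] by (simp only: ch power_add) simp
  qed
  ultimately show ?case by simp
qed

lemma askey_wilson_ex:
  fixes a b c d q :: "'f::field_char_0"
  assumes gen: "AW_generic a b c d q"
  shows "\<exists>P. (\<forall>z. z \<noteq> 0 \<longrightarrow> poly P ((z + inverse z) / 2) = askey_wilson_val n a b c d q z)
             \<and> degree P = n \<and> lead_coeff P = 1"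
proof -
  from gen have q: "q \<noteq> 0" "\<And>m. m \<ge> 1 \<Longrightarrow> q ^ m \<noteq> 1" and a: "a \<noteq> 0"
    by (auto simp: AW_generic_def)
  define D where "D = qpoch (a * b * c * d * q powi (int n - 1)) q"
  define N where "N = qpochs [a * b, a * c, a * d] q"
  define C where "C = N n / (2 ^ n * a ^ n * D n)"
  define t where "t k = qpoch (q powi (- int n)) q k * D k / (qpoch q q k * N k) * q ^ k" for k
  have Nnz: "N k \<noteq> 0" for k
    using gen by (auto simp: N_def qpochs_def AW_generic_def intro!: qpoch_nz)
  have Dnz: "D n \<noteq> 0"
  proof (cases n)
    case 0
    then show ?thesis by (simp add: D_def)
  next
    case (Suc m)
    have "a * b * c * d * q powi (int n - 1) * q ^ j \<noteq> 1" for j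
    proof -
      have "q powi (int n - 1) * q ^ j = q ^ (m + j)"
        using Suc by (simp add: power_add)
      then show ?thesis
        using gen by (metis AW_generic_def mult.assoc)
    qed
    then show ?thesis unfolding D_def by (rule qpoch_nz)
  qed
  define P where "P = (\<Sum>k\<le>n. smult (C * t k) (AW_basis a q k))"
  have val: "poly P ((z + inverse z) / 2) = askey_wilson_val n a b c d q z" if "z \<noteq> 0" for z
  proof -
    have "askey_wilson_val n a b c d q z
        = C * (\<Sum>k\<le>n. t k * (qpoch (a * z) q k * qpoch (a * inverse z) q k))"
      unfolding askey_wilson_val_def basic_hypergeometric_def
      by (subst Sum_any_terminating[of n])
        (use q in \<open>auto simp: C_def N_def D_def t_def qpochs_def qpoch_terminates
            intro!: sum.cong\<close>)
    then show ?thesis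
      by (simp add: P_def poly_sum poly_AW_basis[OF that] sum_distrib_left mult.assoc)
  qed
  have qn: "qpoch q q n \<noteq> 0" using q by (intro qpoch_q_nz)
  have key: "qpoch (q powi (- int n)) q n * q ^ n * ((-1) ^ n * q ^ (n choose 2)) = qpoch q q n"
  proof -
    have "n * n = n + 2 * (n choose 2)"
      by (induction n) (simp_all add: numeral_2_eq_2)
    then have ex: "q ^ (n * n) = q ^ n * q ^ (n choose 2) * q ^ (n choose 2)"
      by (metis mult.assoc mult_2 power_add)
    have "(-1) ^ n * qpoch (q powi (- int n)) q n * q ^ (n * n) = q ^ (n choose 2) * qpoch q q n"
      using qpoch_neg[OF q(1), of n n] qpoch_split[of n n q] by simp
    then have "q ^ (n choose 2) *
        (qpoch (q powi (- int n)) q n * q ^ n * ((-1) ^ n * q ^ (n choose 2)))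
        = q ^ (n choose 2) * qpoch q q n"
      unfolding ex by (simp add: mult_ac)
    then show ?thesis using q by simp
  qed
  have lc: "C * t n * ((-2 * a) ^ n * q ^ (n choose 2)) = 1"
  proof -
    have "(-2 * a) ^ n = (-1) ^ n * 2 ^ n * a ^ n"
      by (metis mult.assoc mult_minus1 power_mult_distrib)
    then have "C * t n * ((-2 * a) ^ n * q ^ (n choose 2))
       = (qpoch (q powi (- int n)) q n * q ^ n * ((-1) ^ n * q ^ (n choose 2))) / qpoch q q n"
      using Nnz[of n] Dnz a qn by (simp add: C_def t_def field_simps)
    then show ?thesis using key qn by simp
  qed
  have Ctnz: "C * t n \<noteq> 0" using lc by auto
  have P: "P = (\<Sum>k<n. smult (C * t k) (AW_basis a q k)) + smult (C * t n) (AW_basis a q n)"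
    by (simp add: P_def lessThan_Suc_atMost[symmetric])
  have "degree P = n \<and> lead_coeff P = 1"
    unfolding P
  proof (rule monic_addI)
    show "degree (smult (C * t n) (AW_basis a q n)) = n"
      using Ctnz AW_basis_degree[OF a q(1)] by (simp only: degree_smult_eq) simp
    show "lead_coeff (smult (C * t n) (AW_basis a q n)) = 1"
      using lc by (simp only: lead_coeff_smult conjunct2[OF AW_basis_degree[OF a q(1)]])
    show "coeff (\<Sum>k<n. smult (C * t k) (AW_basis a q k)) i = 0" if "i \<ge> n" for i
      using that AW_basis_degree[OF a q(1)]
      by (auto simp: coeff_sum intro!: sum.neutral coeff_eq_0)
  qed
  with val show ?thesis by blast
qed

lemma poly_askey_wilson:
  assumes "AW_generic a b c d q"
  shows "z \<noteq> 0 \<Longrightarrow> poly (askey_wilson n a b c d q) ((z + inverse z) / 2) = askey_wilson_val n a b c d q z"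
    and "degree (askey_wilson n a b c d q) = n"
    and "lead_coeff (askey_wilson n a b c d q) = 1"
proof -
  obtain P where P: "\<And>z. z \<noteq> 0 \<Longrightarrow> poly P ((z + inverse z) / 2) = askey_wilson_val n a b c d q z"
    and dP: "degree P = n" "lead_coeff P = 1"
    using askey_wilson_ex[OF assms] by blast
  have "askey_wilson n a b c d q = P"
    unfolding askey_wilson_def by (rule poly_in_x_eqI) (rule P)
  with P dP show "z \<noteq> 0 \<Longrightarrow> poly (askey_wilson n a b c d q) ((z + inverse z) / 2) = askey_wilson_val n a b c d q z"
    and "degree (askey_wilson n a b c d q) = n"
    and "lead_coeff (askey_wilson n a b c d q) = 1"
    by auto
qed

(* twice the Chebyshev polynomials of the first kind *)
fun cheb2 :: "nat \<Rightarrow> 'f::field_char_0 poly" where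
  "cheb2 0 = [:2:]"
| "cheb2 (Suc 0) = [:0, 2:]"
| "cheb2 (Suc (Suc m)) = [:0, 2:] * cheb2 (Suc m) - cheb2 m"

lemma poly_cheb2:
  fixes z :: "'f::field_char_0"
  assumes "z \<noteq> 0"
  shows "poly (cheb2 m) ((z + inverse z) / 2) = z ^ m + inverse z ^ m"
proof (induction m rule: cheb2.induct)
  case (3 m)
  have "(z + inverse z) * (z ^ Suc m + inverse z ^ Suc m) - (z ^ m + inverse z ^ m)
      = z ^ Suc (Suc m) + inverse z ^ Suc (Suc m)"
    using assms by (simp add: distrib_left distrib_right mult.assoc[symmetric])
  moreover have "poly ([:0, 2:] * cheb2 (Suc m) - cheb2 m) x
      = (2 * x) * poly (cheb2 (Suc m)) x - poly (cheb2 m) x" for x :: 'f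
    by simp
  moreover have "2 * ((z + inverse z) / 2) = z + inverse z"
    by simp
  ultimately show ?case
    using 3 by (simp only: cheb2.simps(3))
qed simp_all

lemma cheb2_coeff:
  "(\<forall>i>m. coeff (cheb2 m :: 'f::field_char_0 poly) i = 0) \<and>
   coeff (cheb2 m :: 'f poly) m = (if m = 0 then 2 else 2 ^ m)"
proof (induction m rule: cheb2.induct)
  case (3 m)
  then show ?case
    by (auto simp: coeff_pCons split: nat.splits)
qed (auto simp: coeff_pCons split: nat.splits)

lemma q_hermite_ex:
  fixes q :: "'f::field_char_0"
  assumes q: "q \<noteq> 0" "\<And>m. m \<ge> 1 \<Longrightarrow> q ^ m \<noteq> 1"
  shows "\<exists>P. (\<forall>z. z \<noteq> 0 \<longrightarrow> poly P ((z + inverse z) / 2) = q_hermite_val n q z)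
             \<and> degree P = n \<and> lead_coeff P = 1"
proof -
  define B where "B k = qpoch q q n / (qpoch q q k * qpoch q q (n - k))" for k
  define e where "e k = (if 2 * k \<le> n then n - 2 * k else 2 * k - n)" for k
  have nz: "qpoch q q k \<noteq> 0" for k
    using q by (intro qpoch_q_nz)
  have trm: "qpoch (q powi (- int n)) q k / qpoch q q k
        * ((-1) ^ k * q ^ (k choose 2)) powi (-1) * q ^ (n * k) = B k" if "k \<le> n" for k
  proof -
    have m1: "inverse ((-1) ^ k) = ((-1) ^ k :: 'f)"
      by (metis inverse_1 inverse_minus_eq power_inverse)
    have "qpoch (q powi (- int n)) q k / qpoch q q k
        * ((-1) ^ k * q ^ (k choose 2)) powi (-1) * q ^ (n * k)
        = ((-1) ^ k * qpoch (q powi (- int n)) q k * q ^ (n * k)) / (qpoch q q k * q ^ (k choose 2))"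
      by (simp add: power_int_minus m1 divide_inverse mult_ac)
    also have "\<dots> = (\<Prod>i<k. 1 - q ^ (n - i)) / qpoch q q k"
      using q by (simp add: qpoch_neg[OF q(1) that])
    also have "\<dots> = B k"
      unfolding B_def using nz by (simp add: qpoch_split[OF that] field_simps)
    finally show ?thesis .
  qed
  define P :: "'f poly" where "P = smult (1 / 2 ^ Suc n) (\<Sum>k\<le>n. smult (B k) (cheb2 (e k)))"
  have val: "poly P ((z + inverse z) / 2) = q_hermite_val n q z" if z: "z \<noteq> 0" for z
  proof -
    have zk: "z ^ n * (z powi (-2)) ^ k = z powi (int n - 2 * int k)" for k
    proof -
      have "(z powi (-2)) ^ k = z powi (- (2 * int k))"
        by (metis mult_minus_left power_int_mult power_int_of_nat)
      then show ?thesis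
        using z by (metis (no_types, lifting) diff_conv_add_uminus power_int_add power_int_of_nat)
    qed
    have "basic_hypergeometric [q powi (- int n), 0] [] q (q ^ n * z powi (-2))
        = (\<Sum>k\<le>n. B k * (z powi (-2)) ^ k)"
      unfolding basic_hypergeometric_def
    proof (subst Sum_any_terminating[of n], goal_cases)
      case (1 k)
      then show ?case using q by (simp add: qpochs_def qpoch_terminates)
    next
      case 2
      have one: "qpoch 0 q k = 1" for k :: nat by (simp add: qpoch_def)
      show ?case
      proof (rule sum.cong[OF refl], goal_cases)
        case (1 k)
        then have "B k = qpoch (q powi (- int n)) q k / qpoch q q k
          * ((-1) ^ k * q ^ (k choose 2)) powi (-1) * q ^ (n * k)"
          using trm[of k] by simp
        then show ?case
          by (simp add: qpochs_def one power_mult_distrib power_mult)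
      qed
    qed
    then have lhs: "q_hermite_val n q z = (\<Sum>k\<le>n. B k * z powi (int n - 2 * int k)) / 2 ^ n"
      unfolding q_hermite_val_def zk[symmetric]
      by (simp add: sum_distrib_left sum_divide_distrib mult_ac)
    have cheb: "poly (cheb2 (e k)) ((z + inverse z) / 2)
        = z powi (int n - 2 * int k) + z powi (2 * int k - int n)" for k
    proof (cases "2 * k \<le> n")
      case True
      then have "z powi (int n - 2 * int k) = z ^ e k" "z powi (2 * int k - int n) = inverse z ^ e k"
        by (simp_all add: e_def power_int_def nat_diff_distrib' nat_mult_distrib)
      then show ?thesis by (simp add: poly_cheb2[OF z])
    next
      case False
      then have "z powi (int n - 2 * int k) = inverse z ^ e k" "z powi (2 * int k - int n) = z ^ e k"
        by (simp_all add: e_def power_int_def nat_diff_distrib' nat_mult_distrib)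
      then show ?thesis by (simp add: poly_cheb2[OF z])
    qed
    have flip: "(\<Sum>k\<le>n. B k * z powi (2 * int k - int n)) = (\<Sum>k\<le>n. B k * z powi (int n - 2 * int k))"
      by (rule sum.reindex_bij_witness[of _ "\<lambda>k. n - k" "\<lambda>k. n - k"])
        (auto simp: B_def mult.commute of_nat_diff algebra_simps)
    have "poly P ((z + inverse z) / 2)
        = (\<Sum>k\<le>n. B k * (z powi (int n - 2 * int k) + z powi (2 * int k - int n))) / 2 ^ Suc n"
      by (simp add: P_def poly_sum cheb)
    also have "\<dots> = q_hermite_val n q z"
      by (simp add: distrib_left sum.distrib flip lhs)
    finally show ?thesis .
  qed
  have zero: "coeff P i = 0" if "i > n" for i
  proof -
    have "coeff (cheb2 (e k) :: 'f poly) i = 0" if "k \<le> n" for k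
    proof -
      have "i > e k" using \<open>i > n\<close> that by (auto simp: e_def)
      then show ?thesis using cheb2_coeff by blast
    qed
    then show ?thesis by (simp add: P_def coeff_sum)
  qed
  have top: "coeff P n = 1"
  proof (cases "n = 0")
    case True
    then show ?thesis by (simp add: P_def B_def e_def)
  next
    case False
    have "(\<Sum>k\<le>n. B k * coeff (cheb2 (e k) :: 'f poly) n)
        = (\<Sum>k\<in>{0, n}. B k * coeff (cheb2 (e k) :: 'f poly) n)"
    proof (rule sum.mono_neutral_right)
      show "\<forall>k\<in>{..n} - {0, n}. B k * coeff (cheb2 (e k) :: 'f poly) n = 0"
      proof
        fix k assume "k \<in> {..n} - {0, n}"
        then have "n > e k" by (auto simp: e_def)
        then show "B k * coeff (cheb2 (e k) :: 'f poly) n = 0"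
          using cheb2_coeff[where 'f = 'f] by simp
      qed
    qed auto
    also have "\<dots> = 2 ^ Suc n"
      using False nz[of n] cheb2_coeff[of n, where 'f = 'f] by (simp add: B_def e_def)
    finally show ?thesis by (simp add: P_def coeff_sum)
  qed
  have "degree P = n"
    by (intro antisym degree_le le_degree) (use zero top in auto)
  with val top show ?thesis by (intro exI[of _ P]) auto
qed

lemma poly_q_hermite:
  fixes q :: "'f::field_char_0"
  assumes "q \<noteq> 0" "\<And>m. m \<ge> 1 \<Longrightarrow> q ^ m \<noteq> 1"
  shows "z \<noteq> 0 \<Longrightarrow> poly (q_hermite n q) ((z + inverse z) / 2) = q_hermite_val n q z"
    and "degree (q_hermite n q) = n"
    and "lead_coeff (q_hermite n q) = 1"
proof -
  obtain P where P: "\<And>z. z \<noteq> 0 \<Longrightarrow> poly P ((z + inverse z) / 2) = q_hermite_val n q z"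
    and dP: "degree P = n" "lead_coeff P = 1"
    using q_hermite_ex[OF assms] by blast
  have "q_hermite n q = P"
    unfolding q_hermite_def by (rule poly_in_x_eqI) (rule P)
  with P dP show "z \<noteq> 0 \<Longrightarrow> poly (q_hermite n q) ((z + inverse z) / 2) = q_hermite_val n q z"
    and "degree (q_hermite n q) = n"
    and "lead_coeff (q_hermite n q) = 1"
    by auto
qed

corollary poly_cos:
  fixes a b c d q :: complex and \<theta> :: real
  assumes "AW_generic a b c d q"
  shows "poly (askey_wilson n a b c d q) (of_real (cos \<theta>)) =
           askey_wilson_val n a b c d q (exp (\<i> * of_real \<theta>))"
    and "poly (q_hermite n q) (of_real (cos \<theta>)) = q_hermite_val n q (exp (\<i> * of_real \<theta>))"
proof -
  have c: "of_real (cos \<theta>) = (cis \<theta> + inverse (cis \<theta>)) / 2"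
    by (simp add: complex_eq_iff cis_inverse)
  show "poly (askey_wilson n a b c d q) (of_real (cos \<theta>)) =
           askey_wilson_val n a b c d q (exp (\<i> * of_real \<theta>))"
    unfolding c cis_conv_exp[symmetric] by (rule poly_askey_wilson(1)[OF assms]) simp
  show "poly (q_hermite n q) (of_real (cos \<theta>)) = q_hermite_val n q (exp (\<i> * of_real \<theta>))"
    unfolding c cis_conv_exp[symmetric]
    by (rule poly_q_hermite(1)) (use assms in \<open>auto simp: AW_generic_def\<close>)
qed

lemma monic_basis_expansion:
  fixes p :: "nat \<Rightarrow> 'f::field_char_0 poly"
  assumes p: "\<And>k. degree (p k) = k" "\<And>k. lead_coeff (p k) = 1"
  assumes "\<And>i. i \<ge> m \<Longrightarrow> coeff P i = 0"
  shows "\<exists>!s. (\<forall>k\<ge>m. s k = 0) \<and> P = (\<Sum>k<m. smult (s k) (p k))"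
  using assms(3)
proof (induction m arbitrary: P)
  case 0
  then have "P = 0" by (simp add: poly_eq_iff)
  then show ?case by (auto intro!: ex1I[of _ "\<lambda>_. 0"])
next
  case (Suc m)
  have top: "coeff (p m) m = 1" and high: "\<And>i k. i > k \<Longrightarrow> coeff (p k) i = 0"
    using p by (metis, simp add: coeff_eq_0 p)
  define R where "R = P - smult (coeff P m) (p m)"
  have "coeff R i = 0" if "i \<ge> m" for i
    using that Suc.prems[of i] top high by (cases "i = m") (auto simp: R_def)
  from Suc.IH[OF this] obtain s where s: "\<forall>k\<ge>m. s k = 0" "R = (\<Sum>k<m. smult (s k) (p k))"
    and uniq: "\<And>s'. \<forall>k\<ge>m. s' k = 0 \<Longrightarrow> R = (\<Sum>k<m. smult (s' k) (p k)) \<Longrightarrow> s' = s"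
    by blast
  show ?case
  proof (rule ex1I[of _ "s(m := coeff P m)"])
    have "(\<Sum>k<m. smult ((s(m := coeff P m)) k) (p k)) = R"
      unfolding s(2) by (rule sum.cong) auto
    then show "(\<forall>k\<ge>Suc m. (s(m := coeff P m)) k = 0) \<and>
        P = (\<Sum>k<Suc m. smult ((s(m := coeff P m)) k) (p k))"
      using s(1) by (auto simp: R_def)
  next
    fix s' assume s': "(\<forall>k\<ge>Suc m. s' k = 0) \<and> P = (\<Sum>k<Suc m. smult (s' k) (p k))"
    have "coeff (\<Sum>k<m. smult (s' k) (p k)) m = 0"
      by (auto simp: coeff_sum high intro!: sum.neutral)
    then have cm: "coeff P m = s' m"
      using s' top by simp
    have "R = (\<Sum>k<m. smult ((s'(m := 0)) k) (p k))"
    proof -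
      have "(\<Sum>k<m. smult ((s'(m := 0)) k) (p k)) = (\<Sum>k<m. smult (s' k) (p k))"
        by (rule sum.cong) auto
      then show ?thesis unfolding R_def cm using s' by simp
    qed
    then have "s'(m := 0) = s"
      using s' by (intro uniq) (auto simp: le_Suc_eq Suc_le_eq)
    then show "s' = s(m := coeff P m)"
      using cm by auto
  qed
qed

lemma connection_coeffs_ex1:
  fixes P Q :: "nat \<Rightarrow> 'f::field_char_0 poly"
  assumes "degree (P n) = n" "\<And>k. degree (Q k) = k" "\<And>k. lead_coeff (Q k) = 1"
  shows "\<exists>!s. (\<forall>k>n. s k = 0) \<and> P n = (\<Sum>k\<le>n. smult (s k) (Q k))"
  using monic_basis_expansion[of Q "Suc n" "P n"] assms
  by (simp add: coeff_eq_0 Suc_le_eq lessThan_Suc_atMost)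

lemma connection_coeffs_expansion:
  fixes P Q :: "nat \<Rightarrow> 'f::field_char_0 poly"
  assumes "degree (P n) = n" "\<And>k. degree (Q k) = k" "\<And>k. lead_coeff (Q k) = 1"
  shows "P n = (\<Sum>k\<le>n. smult (connection_coeffs P Q n k) (Q k))"
  using theI'[OF connection_coeffs_ex1[of P n Q, OF assms]]
  unfolding connection_coeffs_def by blast

corollary sigma_nu_AW_H_expansion:
  assumes gen: "AW_generic a b c d q"
  shows "q_hermite n q = (\<Sum>k\<le>n. smult (sigma_AW_H n k a b c d q) (askey_wilson k a b c d q))"
    and "askey_wilson n a b c d q = (\<Sum>k\<le>n. smult (nu_AW_H n k a b c d q) (q_hermite k q))"
proof -
  from gen have q: "q \<noteq> 0" "\<And>m. m \<ge> 1 \<Longrightarrow> q ^ m \<noteq> 1"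
    by (auto simp: AW_generic_def)
  show "q_hermite n q = (\<Sum>k\<le>n. smult (sigma_AW_H n k a b c d q) (askey_wilson k a b c d q))"
    unfolding sigma_AW_H_def
    by (rule connection_coeffs_expansion)
      (use poly_askey_wilson[OF gen] poly_q_hermite[OF q] in auto)
  show "askey_wilson n a b c d q = (\<Sum>k\<le>n. smult (nu_AW_H n k a b c d q) (q_hermite k q))"
    unfolding nu_AW_H_def
    by (rule connection_coeffs_expansion)
      (use poly_askey_wilson[OF gen] poly_q_hermite[OF q] in auto)
qed

end

theory Submission
  imports Defs
begin

text \<open>
  The polynomial \<open>p\<^sub>n(x;a,b,c,d|q)\<close> is an eigenfunction of the Askey--Wilson \<open>q\<close>-difference operator,
  whose coefficients are symmetric in \<open>a,b,c,d\<close>. The operator is triangular with respect to the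
  degree and its eigenvalues are distinct, so \<open>p\<^sub>n\<close> is its only monic
  eigenpolynomial of degree \<open>n\<close>. Hence \<open>p\<^sub>n\<close>, and with it every connection coefficient, is symmetric.
\<close>

section \<open>The Askey-Wilson operator and its linearity\<close>

definition AW_weight :: "'f::field_char_0 \<Rightarrow> 'f \<Rightarrow> 'f \<Rightarrow> 'f \<Rightarrow> 'f \<Rightarrow> 'f \<Rightarrow> 'f" where
  "AW_weight a b c d q z =
     (1 - a * z) * (1 - b * z) * (1 - c * z) * (1 - d * z) / ((1 - z\<^sup>2) * (1 - q * z\<^sup>2))"

text \<open>The operator acts on functions of \<open>z\<close> because the shift from
  \<open>z\<close> to \<open>q * z\<close> does not descend to a map of x = (z + 1/z)/2. For
  \<open>f\<close> invariant under inversion of \<open>z\<close>, the second summand is the first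
  one with \<open>z\<close> replaced by 1/z.\<close>

definition AW_op ::
  "'f::field_char_0 \<Rightarrow> 'f \<Rightarrow> 'f \<Rightarrow> 'f \<Rightarrow> 'f \<Rightarrow> ('f \<Rightarrow> 'f) \<Rightarrow> 'f \<Rightarrow> 'f" where
  "AW_op a b c d q f z =
     AW_weight a b c d q z * (f (q * z) - f z)
     + AW_weight a b c d q (inverse z) * (f (z / q) - f z)"

text \<open>Here \<open>s\<close> stands for the product abcd, so the eigenvalue is visibly
  symmetric. Writing \<open>q ^ n / q\<close> gives the exponent n - 1 its integer meaning at n = 0
  too.\<close>

definition AW_eigval :: "'f::field_char_0 \<Rightarrow> 'f \<Rightarrow> nat \<Rightarrow> 'f" where
  "AW_eigval s q n = (1 - q ^ n) * (1 - s * q ^ n / q) / q ^ n"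

text \<open>These are the nonzero \<open>z\<close> at which neither \<open>AW_weight\<close> at
  \<open>z\<close> nor \<open>AW_weight\<close> at 1/z has a vanishing denominator.\<close>

definition AW_regular :: "'f::field_char_0 \<Rightarrow> 'f \<Rightarrow> bool" where
  "AW_regular q z \<longleftrightarrow> z \<noteq> 0 \<and> z\<^sup>2 \<noteq> 1 \<and> q * z\<^sup>2 \<noteq> 1 \<and> z\<^sup>2 \<noteq> q"

lemma AW_op_add: "AW_op a b c d q (\<lambda>z. f z + g z) z = AW_op a b c d q f z + AW_op a b c d q g z"
  by (simp add: AW_op_def algebra_simps)

lemma AW_op_cmult: "AW_op a b c d q (\<lambda>z. r * f z) z = r * AW_op a b c d q f z"
  by (simp add: AW_op_def algebra_simps)

lemma AW_op_const [simp]: "AW_op a b c d q (\<lambda>z. r) z = 0"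
  by (simp add: AW_op_def)

lemma AW_op_sum:
  "AW_op a b c d q (\<lambda>z. \<Sum>k\<in>K. f k z) z = (\<Sum>k\<in>K. AW_op a b c d q (f k) z)"
  by (induction K rule: infinite_finite_induct) (simp_all add: AW_op_add)

text \<open>Agreement is asked at nonzero points, which is where a polynomial in x is known to match
  its closed form; \<open>q * z\<close> and \<open>z / q\<close> stay in that range.\<close>

lemma AW_op_cong:
  assumes "\<And>z. z \<noteq> 0 \<Longrightarrow> f z = g z" "q \<noteq> 0" "z \<noteq> 0"
  shows "AW_op a b c d q f z = AW_op a b c d q g z"
  using assms by (simp add: AW_op_def)

section \<open>Action of the operator on the basis (az, a/z; q)_k\<close>

lemma qpoch_Suc_shift: "qpoch z q (Suc n) = (1 - z) * qpoch (z * q) q n"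
  unfolding qpoch_def prod.lessThan_Suc_shift by (simp add: mult.assoc)

text \<open>The factor 1 - az of the weight completes (aqz; q)_{k+1} to (az; q)_{k+2}. Then both
  terms of the difference contain (1 - azq^k) times \<open>\<phi> k z\<close>, and the bracket that
  remains is a multiple of 1 - qz^2, which cancels against the weight.\<close>

lemma AW_basis_shift:
  fixes a b c d q z :: "'f::field_char_0"
  assumes "AW_regular q z" "q \<noteq> 0"
  defines "\<phi> \<equiv> \<lambda>k z. qpoch (a * z) q k * qpoch (a * inverse z) q k"
  shows "AW_weight a b c d q z * (\<phi> (Suc k) (q * z) - \<phi> (Suc k) z)
       = - (1 - q * q ^ k) * (a / q) * ((1 - a * q ^ k * z) * (1 - b * z) * (1 - c * z) * (1 - d * z))
           / (z * (1 - z\<^sup>2)) * \<phi> k z"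
proof -
  define u where "u = q ^ k"
  define B where "B = (1 - b * z) * (1 - c * z) * (1 - d * z)"
  have z: "z \<noteq> 0" "1 - z\<^sup>2 \<noteq> 0" "1 - q * z\<^sup>2 \<noteq> 0"
    using assms(1) by (auto simp: AW_regular_def)
  have "(1 - a * z) * qpoch (a * (q * z)) q (Suc k) = qpoch (a * z) q (Suc (Suc k))"
    by (subst (2) qpoch_Suc_shift) (simp only: mult_ac)
  then have s1: "(1 - a * z) * qpoch (a * (q * z)) q (Suc k)
      = qpoch (a * z) q k * (1 - a * z * u) * (1 - a * z * (q * u))"
    by (simp add: u_def)
  have "a * inverse (q * z) * q = a * inverse z"
    using assms by (simp add: field_simps)
  then have s2: "qpoch (a * inverse (q * z)) q (Suc k)
      = (1 - a * inverse (q * z)) * qpoch (a * inverse z) q k"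
    by (simp only: qpoch_Suc_shift)
  have "(1 - a * z) * (\<phi> (Suc k) (q * z) - \<phi> (Suc k) z)
      = ((1 - a * z) * qpoch (a * (q * z)) q (Suc k)) * qpoch (a * inverse (q * z)) q (Suc k)
        - (1 - a * z) * (qpoch (a * z) q (Suc k) * qpoch (a * inverse z) q (Suc k))"
    by (simp add: \<phi>_def algebra_simps del: qpoch_Suc)
  also have "\<dots> = (1 - a * z * u) * \<phi> k z * ((1 - a * z * (q * u)) * (1 - a * inverse (q * z))
      - (1 - a * z) * (1 - a * inverse z * u))"
    unfolding s1 s2 by (simp add: \<phi>_def u_def algebra_simps)
  also have "(1 - a * z * (q * u)) * (1 - a * inverse (q * z)) - (1 - a * z) * (1 - a * inverse z * u)
      = - (1 - q * u) * (a / q) * (1 - q * z\<^sup>2) / z"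
    using z assms(2) by (simp add: field_simps power2_eq_square)
  finally have *: "(1 - a * z) * (\<phi> (Suc k) (q * z) - \<phi> (Suc k) z)
      = (1 - a * z * u) * \<phi> k z * (- (1 - q * u) * (a / q) * (1 - q * z\<^sup>2) / z)" .
  have "AW_weight a b c d q z * (\<phi> (Suc k) (q * z) - \<phi> (Suc k) z)
      = B / ((1 - z\<^sup>2) * (1 - q * z\<^sup>2)) * ((1 - a * z) * (\<phi> (Suc k) (q * z) - \<phi> (Suc k) z))"
    by (simp add: AW_weight_def B_def mult_ac)
  also have "\<dots> = - (1 - q * u) * (a / q) * ((1 - a * u * z) * B) / (z * (1 - z\<^sup>2)) * \<phi> k z"
    unfolding * using z by (simp add: divide_simps mult_ac)
  finally show ?thesis
    by (simp add: B_def u_def mult.assoc)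
qed

text \<open>The operator is bidiagonal in this basis. Adding \<open>AW_basis_shift\<close> at
  \<open>z\<close> and at 1/z gives \<open>\<phi> k z\<close> times an expression linear in z + 1/z,
  which is then expanded in the last factor of \<open>\<phi> (Suc k) z\<close> and a
  constant.\<close>

lemma AW_op_basis:
  fixes a b c d q z :: "'f::field_char_0"
  assumes reg: "AW_regular q z" and q: "q \<noteq> 0"
  defines "\<phi> \<equiv> \<lambda>k z. qpoch (a * z) q k * qpoch (a * inverse z) q k"
  shows "AW_op a b c d q (\<phi> (Suc k)) z
       = AW_eigval (a * b * c * d) q (Suc k) * \<phi> (Suc k) z
         - (1 - q ^ Suc k) * (1 - a * b * q ^ k) * (1 - a * c * q ^ k) * (1 - a * d * q ^ k)
             / q ^ Suc k * \<phi> k z"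
proof -
  define u where "u = q ^ k"
  define w where "w = inverse z"
  have z: "z \<noteq> 0" "1 - z\<^sup>2 \<noteq> 0" and u: "u \<noteq> 0"
    using reg q by (auto simp: AW_regular_def u_def)
  have w: "w \<noteq> 0" "1 - w\<^sup>2 \<noteq> 0" "z * w = 1" "AW_regular q w"
    using reg q by (auto simp: AW_regular_def w_def field_simps)
  have inv: "\<phi> j (inverse y) = \<phi> j y" for j y
    by (simp add: \<phi>_def mult.commute)
  have s1: "AW_weight a b c d q z * (\<phi> (Suc k) (q * z) - \<phi> (Suc k) z)
      = - (1 - q * u) * (a / q) * ((1 - a * u * z) * (1 - b * z) * (1 - c * z) * (1 - d * z))
        / (z * (1 - z\<^sup>2)) * \<phi> k z"
    unfolding \<phi>_def u_def by (rule AW_basis_shift[OF reg q])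
  have s2: "AW_weight a b c d q w * (\<phi> (Suc k) (q * w) - \<phi> (Suc k) w)
      = - (1 - q * u) * (a / q) * ((1 - a * u * w) * (1 - b * w) * (1 - c * w) * (1 - d * w))
        / (w * (1 - w\<^sup>2)) * \<phi> k w"
    unfolding \<phi>_def u_def by (rule AW_basis_shift[OF w(4) q])
  have qw: "\<phi> (Suc k) (z / q) = \<phi> (Suc k) (q * w)"
    using inv[of "Suc k" "z / q"] z q by (simp add: w_def field_simps)
  have ww: "\<phi> j w = \<phi> j z" for j
    by (simp add: w_def inv)
  \<comment> \<open>Rewriting the half at 1/z over the denominator of the half at \<open>z\<close>
    produces a minus sign, so the sum of the halves becomes a difference.\<close>
  have flip: "((1 - x1 * w) * (1 - x2 * w) * (1 - x3 * w) * (1 - x4 * w)) / (w * (1 - w\<^sup>2))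
      = - ((z - x1) * (z - x2) * (z - x3) * (z - x4)) / (z * (1 - z\<^sup>2))" for x1 x2 x3 x4
  proof -
    have *: "1 - x * w = (z - x) / z" for x
      using z by (simp add: w_def field_simps)
    have **: "w * (1 - w\<^sup>2) = - (1 - z\<^sup>2) / z ^ 3"
      using z by (simp add: w_def field_simps power2_eq_square power3_eq_cube)
    have "(x / z) * (y / z) * (u / z) * (v / z) / (- D / z ^ 3) = - (x * y * u * v) / (z * D)"
      if "D \<noteq> 0" for x y u v D
      using z(1) that by (simp add: field_simps power3_eq_cube)
    from this[OF z(2)] show ?thesis
      unfolding * ** .
  qed
  \<comment> \<open>The numerator vanishes at z = 1 and z = -1, so 1 - z^2 divides it exactly;
    dividing by \<open>z\<close> as well leaves an expression symmetric under inversion.\<close>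
  have core: "((1 - x1 * z) * (1 - x2 * z) * (1 - x3 * z) * (1 - x4 * z)
        - (z - x1) * (z - x2) * (z - x3) * (z - x4)) / (z * (1 - z\<^sup>2))
      = (1 - x1 * x2 * x3 * x4) * (z + w)
        - (x1 + x2 + x3 + x4 - x2 * x3 * x4 - x1 * x3 * x4 - x1 * x2 * x4 - x1 * x2 * x3)"
    (is "?N / _ = ?R") for x1 x2 x3 x4
  proof -
    have "?R * z = (1 - x1 * x2 * x3 * x4) * (z * z + 1)
        - (x1 + x2 + x3 + x4 - x2 * x3 * x4 - x1 * x3 * x4 - x1 * x2 * x4 - x1 * x2 * x3) * z"
      using w(3) by algebra
    then have "?R * z * (1 - z\<^sup>2) = ((1 - x1 * x2 * x3 * x4) * (z * z + 1)
        - (x1 + x2 + x3 + x4 - x2 * x3 * x4 - x1 * x3 * x4 - x1 * x2 * x4 - x1 * x2 * x3) * z)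
        * (1 - z\<^sup>2)"
      by (simp only:)
    also have "\<dots> = ?N"
      by algebra
    finally show ?thesis
      using z by (simp add: divide_eq_eq mult.assoc)
  qed
  \<comment> \<open>This value makes (1 - xz)(1 - xw) the quotient of
    \<open>\<phi> (Suc k) z\<close> by \<open>\<phi> k z\<close>.\<close>
  define x where "x = a * u"
  define E where "E = (1 - x * b * c * d) * (z + w)
        - (x + b + c + d - b * c * d - x * c * d - x * b * d - x * b * c)"
  have "AW_op a b c d q (\<phi> (Suc k)) z
      = - (1 - q * u) * (a / q) * \<phi> k z *
         (((1 - x * z) * (1 - b * z) * (1 - c * z) * (1 - d * z)) / (z * (1 - z\<^sup>2))
          + ((1 - x * w) * (1 - b * w) * (1 - c * w) * (1 - d * w)) / (w * (1 - w\<^sup>2)))"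
    unfolding AW_op_def qw w_def[symmetric] s1 s2[unfolded ww] x_def
    by (simp only: distrib_left times_divide_eq_left times_divide_eq_right mult_ac)
  also have "\<dots> = - (1 - q * u) * (a / q) * \<phi> k z * E"
    unfolding flip E_def core[symmetric] by (simp add: diff_divide_distrib)
  also have "\<dots> = (1 - q * u) / (u * q) * \<phi> k z * (- x * E)"
    using u q by (simp add: x_def field_simps)
  \<comment> \<open>Division with remainder by (1 - xz)(1 - xw), both sides being linear in z + w:
    the quotient gives the eigenvalue, the remainder the coefficient of
    \<open>\<phi> k z\<close>.\<close>
  also have "- x * E = (1 - x * b * c * d) * ((1 - x * z) * (1 - x * w))
      - (1 - x * b) * (1 - x * c) * (1 - x * d)"
    unfolding E_def using w(3) by algebra
  also have "r * y * (g * v - m) = r * g * (y * v) - r * m * y" for r y g v m :: 'f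
    by algebra
  finally have "AW_op a b c d q (\<phi> (Suc k)) z
      = (1 - q * u) / (u * q) * (1 - x * b * c * d) * (\<phi> k z * ((1 - x * z) * (1 - x * w)))
        - (1 - q * u) / (u * q) * ((1 - x * b) * (1 - x * c) * (1 - x * d)) * \<phi> k z" .
  moreover have "\<phi> (Suc k) z = \<phi> k z * ((1 - x * z) * (1 - x * w))"
    by (simp add: \<phi>_def x_def u_def w_def mult_ac)
  moreover have "AW_eigval (a * b * c * d) q (Suc k) = (1 - q * u) / (u * q) * (1 - x * b * c * d)"
    using q by (simp add: AW_eigval_def x_def u_def mult_ac)
  ultimately show ?thesis
    by (simp add: u_def x_def mult_ac)
qed

section \<open>Askey-Wilson polynomials are eigenfunctions\<close>

lemma askey_wilson_val_sum:
  fixes a b c d q :: "'f::field_char_0" and n :: nat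
  assumes "q \<noteq> 0"
  defines "s \<equiv> a * b * c * d * q powi (int n - 1)"
  shows "askey_wilson_val n a b c d q z =
    qpochs [a * b, a * c, a * d] q n / (2 ^ n * a ^ n * qpoch s q n)
    * (\<Sum>k\<le>n. qpoch (q powi (- int n)) q k * qpoch s q k
        / (qpoch q q k * qpochs [a * b, a * c, a * d] q k) * q ^ k
        * (qpoch (a * z) q k * qpoch (a * inverse z) q k))"
  unfolding askey_wilson_val_def basic_hypergeometric_def s_def
  by (subst Sum_any_terminating[of n])
    (use assms in \<open>auto simp: qpochs_def qpoch_terminates intro!: sum.cong\<close>)

text \<open>The factored difference serves twice: it matches the ratio of consecutive coefficients
  of p_n, and it shows that eigenvalues for different degrees differ.\<close>

lemma AW_eigval_diff:
  assumes "q \<noteq> 0"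
  shows "AW_eigval s q k - AW_eigval s q n = (1 / q ^ k - 1 / q ^ n) * (1 - s * q ^ (n + k) / q)"
  using assms by (simp add: AW_eigval_def power_add field_simps)

text \<open>Since the operator is bidiagonal in the basis, the eigenvalue equation is a two-term
  recurrence for the coefficients, and the hypergeometric coefficients \<open>t\<close> satisfy
  it.\<close>

lemma AW_op_askey_wilson_val:
  fixes a b c d q z :: "'f::field_char_0"
  assumes gen: "AW_generic a b c d q" and reg: "AW_regular q z"
  shows "AW_op a b c d q (askey_wilson_val n a b c d q) z
       = AW_eigval (a * b * c * d) q n * askey_wilson_val n a b c d q z"
proof -
  define s where "s = a * b * c * d"
  define D where "D = qpoch (s * q powi (int n - 1)) q"
  define N where "N = qpochs [a * b, a * c, a * d] q"
  define C where "C = N n / (2 ^ n * a ^ n * D n)"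
  define \<phi> where "\<phi> k z = qpoch (a * z) q k * qpoch (a * inverse z) q k" for k z
  define t where "t k = qpoch (q powi (- int n)) q k * D k / (qpoch q q k * N k) * q ^ k" for k
  define \<mu> where
    "\<mu> k = (1 - q ^ Suc k) * (1 - a * b * q ^ k) * (1 - a * c * q ^ k) * (1 - a * d * q ^ k) / q ^ Suc k"
    for k
  have q: "q \<noteq> 0" "\<And>m. m \<ge> 1 \<Longrightarrow> q ^ m \<noteq> 1"
    using gen by (auto simp: AW_generic_def)
  have Nnz: "N k \<noteq> 0" for k
    using gen by (auto simp: N_def qpochs_def AW_generic_def intro!: qpoch_nz)
  have qnz: "qpoch q q k \<noteq> 0" for k
    using q by (intro qpoch_q_nz)
  have val: "askey_wilson_val n a b c d q y = C * (\<Sum>k\<le>n. t k * \<phi> k y)" for y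
    unfolding askey_wilson_val_sum[OF q(1)] C_def N_def D_def t_def \<phi>_def s_def by simp
  \<comment> \<open>This is the comparison of the coefficients of \<open>\<phi> k\<close> in the
    eigenvalue equation.\<close>
  have rec: "t (Suc k) * \<mu> k = t k * (AW_eigval s q k - AW_eigval s q n)" if "k < n" for k
  proof -
    define M where "M = (1 - a * b * q ^ k) * (1 - a * c * q ^ k) * (1 - a * d * q ^ k)"
    have NS: "N (Suc k) = N k * M"
      by (simp add: N_def M_def qpochs_def mult_ac)
    then have M: "M \<noteq> 0" using Nnz[of "Suc k"] by auto
    have Q: "1 - q ^ Suc k \<noteq> 0" using q(2)[of "Suc k"] by simp
    have DS: "D (Suc k) = D k * (1 - s * q ^ (n + k) / q)"
      using q by (simp add: D_def power_int_diff power_add)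
    have QS: "qpoch q q (Suc k) = qpoch q q k * (1 - q ^ Suc k)"
      by simp
    have cancel: "x * e * (y * g) / (h * r * (p * M)) * v * (r * M / v) = x * y / (h * p) * (e * g)"
      if "h \<noteq> 0" "r \<noteq> 0" "p \<noteq> 0" "v \<noteq> 0" for x e y g h r p v
      using that M by (simp add: field_simps)
    have "\<mu> k = (1 - q ^ Suc k) * M / q ^ Suc k"
      by (simp only: \<mu>_def M_def mult.assoc)
    then have "t (Suc k) * \<mu> k = qpoch (q powi (- int n)) q k * D k / (qpoch q q k * N k)
        * ((1 - q powi (- int n) * q ^ k) * (1 - s * q ^ (n + k) / q))"
      unfolding t_def NS DS QS qpoch_Suc[of "q powi (- int n)"]
      using cancel[OF qnz Q Nnz power_not_zero[OF q(1)]] by (simp only:)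
    also have "1 - q powi (- int n) * q ^ k = q ^ k * (1 / q ^ k - 1 / q ^ n)"
      using q(1) by (simp add: power_int_minus field_simps)
    also have "qpoch (q powi (- int n)) q k * D k / (qpoch q q k * N k)
        * (q ^ k * (1 / q ^ k - 1 / q ^ n) * (1 - s * q ^ (n + k) / q))
      = t k * ((1 / q ^ k - 1 / q ^ n) * (1 - s * q ^ (n + k) / q))"
      by (simp only: t_def mult.assoc)
    finally show ?thesis by (simp only: AW_eigval_diff[OF q(1)])
  qed
  have op: "AW_op a b c d q (\<phi> (Suc k)) z = AW_eigval s q (Suc k) * \<phi> (Suc k) z - \<mu> k * \<phi> k z" for k
    unfolding \<phi>_def s_def \<mu>_def by (rule AW_op_basis[OF reg q(1)])
  \<comment> \<open>The sum telescopes: by \<open>rec\<close>, the boundary term at \<open>m\<close>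
    cancels the lower term contributed by \<open>\<phi> (Suc m)\<close>. At m = n the boundary term
    contains a difference of equal eigenvalues and vanishes.\<close>
  have partial: "(\<Sum>k\<le>m. t k * AW_op a b c d q (\<phi> k) z)
      = AW_eigval s q n * (\<Sum>k\<le>m. t k * \<phi> k z) + t m * (AW_eigval s q m - AW_eigval s q n) * \<phi> m z"
    if "m \<le> n" for m
    using that
  proof (induction m)
    case 0
    then show ?case by (simp add: \<phi>_def AW_eigval_def)
  next
    case (Suc m)
    then have "m < n" "m \<le> n" by auto
    then show ?case
      unfolding sum.atMost_Suc Suc.IH[OF \<open>m \<le> n\<close>] op rec[OF \<open>m < n\<close>, symmetric]
      by (simp add: algebra_simps)
  qed
  show ?thesis
    unfolding val s_def[symmetric] by (simp add: AW_op_cmult AW_op_sum partial)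
qed

section \<open>Uniqueness of the monic eigenpolynomial\<close>

lemma laurent_poly_unique_regular:
  fixes P Q :: "'f::field_char_0 poly"
  assumes q: "q \<noteq> 0"
    and eq: "\<And>z. AW_regular q z \<Longrightarrow> poly P ((z + inverse z) / 2) = poly Q ((z + inverse z) / 2)"
  shows "P = Q"
proof -
  \<comment> \<open>\<open>W\<close> is \<open>(1 - z\<^sup>2) (1 - z\<^sup>-\<^sup>2) (1 - q z\<^sup>2) (1 - q z\<^sup>-\<^sup>2)\<close> written in \<open>x = (z + z\<^sup>-\<^sup>1) / 2\<close>.\<close>
  define W where "W = [:4, 0, -4:] * [:(1 + q)\<^sup>2, 0, -4 * q:]"
  have W: "poly W ((z + inverse z) / 2) = (1 - z\<^sup>2) * (1 - (inverse z)\<^sup>2)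
      * ((1 - q * z\<^sup>2) * (1 - q * (inverse z)\<^sup>2))" if "z \<noteq> 0" for z
  proof -
    define w where "w = inverse z"
    have zw: "z * w = 1" using that by (simp add: w_def)
    have "4 - (z + w) * (z + w) = (1 - z\<^sup>2) * (1 - w\<^sup>2)"
      and "(1 + q)\<^sup>2 - q * ((z + w) * (z + w)) = (1 - q * z\<^sup>2) * (1 - q * w\<^sup>2)"
      using zw by algebra+
    moreover have "poly W x = (4 - (2 * x) * (2 * x)) * ((1 + q)\<^sup>2 - q * ((2 * x) * (2 * x)))" for x
      by (simp add: W_def algebra_simps)
    moreover have "2 * ((z + w) / 2) = z + w"
      by simp
    ultimately show ?thesis by (simp only: w_def)
  qed
  \<comment> \<open>\<open>W\<close> vanishes at every nonzero point that is not regular, so the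
    products agree at all nonzero \<open>z\<close>, and \<open>W\<close> can be cancelled
    afterwards.\<close>
  have "P * W = Q * W"
  proof (rule laurent_poly_unique)
    fix z :: 'f assume z: "z \<noteq> 0"
    show "poly (P * W) ((z + inverse z) / 2) = poly (Q * W) ((z + inverse z) / 2)"
    proof (cases "AW_regular q z")
      case True
      then show ?thesis by (simp add: eq)
    next
      case False
      then have "poly W ((z + inverse z) / 2) = 0"
        using z by (auto simp: W AW_regular_def power_inverse)
      then show ?thesis by simp
    qed
  qed
  moreover have "W \<noteq> 0" using q by (simp add: W_def)
  ultimately show ?thesis by simp
qed

text \<open>Induction on the degree bound: a multiple of the basis polynomial of degree
  \<open>Suc m\<close> removes the top coefficient, and \<open>AW_op_basis\<close> gives its image,
  whose leading coefficient is scaled by the eigenvalue.\<close>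

lemma AW_op_triangular:
  fixes a b c d q :: "'f::field_char_0" and P :: "'f poly"
  assumes q: "q \<noteq> 0" and a: "a \<noteq> 0" and deg: "degree P \<le> m"
  shows "\<exists>E. degree E \<le> m \<and> coeff E m = AW_eigval (a * b * c * d) q m * coeff P m \<and>
    (\<forall>z. AW_regular q z \<longrightarrow>
       AW_op a b c d q (\<lambda>z. poly P ((z + inverse z) / 2)) z = poly E ((z + inverse z) / 2))"
  using deg
proof (induction m arbitrary: P)
  case 0
  then obtain r where "P = [:r:]" by (metis degree_0_id le_zero_eq)
  then show ?case
    by (intro exI[of _ 0]) (simp add: AW_eigval_def)
next
  case (Suc m)
  let ?x = "\<lambda>z::'f. (z + inverse z) / 2"
  define B where "B = AW_basis a q (Suc m)"
  define s where "s = a * b * c * d"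
  define \<mu> where
    "\<mu> = (1 - q ^ Suc m) * (1 - a * b * q ^ m) * (1 - a * c * q ^ m) * (1 - a * d * q ^ m) / q ^ Suc m"
  have B: "degree B = Suc m" "coeff B (Suc m) \<noteq> 0" and B': "degree (AW_basis a q m) = m"
    using AW_basis_degree[OF a q, of "Suc m"] AW_basis_degree[OF a q, of m] a q
    by (auto simp: B_def)
  define r where "r = coeff P (Suc m) / coeff B (Suc m)"
  define R where "R = P - smult r B"
  have "degree R \<le> m"
  proof (rule degree_le, intro allI impI)
    fix i assume "m < i"
    then show "coeff R i = 0"
      using B Suc.prems by (cases "i = Suc m") (auto simp: R_def r_def coeff_eq_0)
  qed
  from Suc.IH[OF this] obtain E where E: "degree E \<le> m"
    "\<And>z. AW_regular q z \<Longrightarrow> AW_op a b c d q (\<lambda>z. poly R (?x z)) z = poly E (?x z)"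
    by blast
  \<comment> \<open>The image of \<open>R\<close> plus \<open>r\<close> times the image of
    \<open>B\<close>.\<close>
  define F where "F = E + smult r (smult (AW_eigval s q (Suc m)) B - smult \<mu> (AW_basis a q m))"
  have "degree F \<le> Suc m"
    unfolding F_def using E(1) B B'
    by (intro degree_add_le degree_smult_le[THEN order_trans] degree_diff_le) auto
  moreover have "coeff F (Suc m) = AW_eigval s q (Suc m) * coeff P (Suc m)"
    using E(1) B B' by (simp add: F_def r_def coeff_eq_0)
  moreover have "AW_op a b c d q (\<lambda>z. poly P (?x z)) z = poly F (?x z)" if reg: "AW_regular q z" for z
  proof -
    have z: "z \<noteq> 0" using reg by (simp add: AW_regular_def)
    have "AW_op a b c d q (\<lambda>z. poly B (?x z)) z
        = AW_op a b c d q (\<lambda>z. qpoch (a * z) q (Suc m) * qpoch (a * inverse z) q (Suc m)) z"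
      by (rule AW_op_cong) (simp_all add: B_def poly_AW_basis q z del: qpoch_Suc)
    also have "\<dots> = AW_eigval s q (Suc m) * poly B (?x z) - \<mu> * poly (AW_basis a q m) (?x z)"
      unfolding AW_op_basis[OF reg q] by (simp add: B_def poly_AW_basis z s_def \<mu>_def del: qpoch_Suc)
    finally have "AW_op a b c d q (\<lambda>z. poly B (?x z)) z
        = AW_eigval s q (Suc m) * poly B (?x z) - \<mu> * poly (AW_basis a q m) (?x z)" .
    moreover have "(\<lambda>z. poly P (?x z)) = (\<lambda>z. poly R (?x z) + r * poly B (?x z))"
      by (simp add: R_def)
    ultimately show ?thesis
      using E(2)[OF reg] by (simp add: AW_op_add AW_op_cmult F_def)
  qed
  ultimately show ?case unfolding s_def by blast
qed

text \<open>A nonzero difference of two such polynomials has some degree m < n, as the leading terms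
  cancel. It has eigenvalue number n, while triangularity forces eigenvalue number m on its leading
  coefficient; genericity makes these two distinct.\<close>

lemma AW_op_eigenpoly_unique:
  fixes a b c d q :: "'f::field_char_0" and P Q :: "'f poly"
  assumes gen: "AW_generic a b c d q"
    and P: "degree P = n" "lead_coeff P = 1" and Q: "degree Q = n" "lead_coeff Q = 1"
    and eigen: "\<And>R z. R \<in> {P, Q} \<Longrightarrow> AW_regular q z \<Longrightarrow>
      AW_op a b c d q (\<lambda>z. poly R ((z + inverse z) / 2)) z
        = AW_eigval (a * b * c * d) q n * poly R ((z + inverse z) / 2)"
  shows "P = Q"
proof (rule ccontr)
  assume "P \<noteq> Q"
  let ?x = "\<lambda>z::'f. (z + inverse z) / 2"
  define s where "s = a * b * c * d"
  define R where "R = P - Q"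
  define m where "m = degree R"
  have q: "q \<noteq> 0" "\<And>m. m \<ge> 1 \<Longrightarrow> q ^ m \<noteq> 1" and a: "a \<noteq> 0"
    and s: "\<And>m. s * q ^ m \<noteq> 1"
    using gen by (auto simp: AW_generic_def s_def)
  have R: "coeff R m \<noteq> 0"
    using \<open>P \<noteq> Q\<close> by (simp only: R_def m_def leading_coeff_0_iff right_minus_eq not_False_eq_True)
  have "m \<le> n"
    unfolding m_def R_def using P Q by (intro degree_diff_le) auto
  moreover have "coeff R n = 0"
    using P Q by (simp add: R_def)
  ultimately have "m < n" using R by (cases "m = n") auto
  obtain E where E: "coeff E m = AW_eigval s q m * coeff R m"
    "\<And>z. AW_regular q z \<Longrightarrow> AW_op a b c d q (\<lambda>z. poly R (?x z)) z = poly E (?x z)"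
    using AW_op_triangular[OF q(1) a, of R m b c d] unfolding s_def m_def by blast
  have "smult (AW_eigval s q n) R = E"
  proof (rule laurent_poly_unique_regular[OF q(1)])
    fix z assume reg: "AW_regular q z"
    have "(\<lambda>z. poly R (?x z)) = (\<lambda>z. poly P (?x z) + (-1) * poly Q (?x z))"
      by (simp add: R_def)
    then have "poly E (?x z) = AW_op a b c d q (\<lambda>z. poly P (?x z)) z
        + (-1) * AW_op a b c d q (\<lambda>z. poly Q (?x z)) z"
      using E(2)[OF reg] by (simp only: AW_op_add AW_op_cmult)
    then show "poly (smult (AW_eigval s q n) R) (?x z) = poly E (?x z)"
      using eigen[of P, OF _ reg] eigen[of Q, OF _ reg] by (simp add: R_def s_def algebra_simps)
  qed
  then have "coeff E m = AW_eigval s q n * coeff R m" by (metis coeff_smult)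
  with E(1) R have "AW_eigval s q m - AW_eigval s q n = 0" by simp
  then have "(1 / q ^ m - 1 / q ^ n) * (1 - s * q ^ (n + m) / q) = 0"
    by (simp only: AW_eigval_diff[OF q(1)])
  \<comment> \<open>As m < n, the exponent n + m - 1 is a natural number, so genericity
    applies.\<close>
  moreover have "s * q ^ (n + m) / q \<noteq> 1"
    using s[of "n + m - 1"] \<open>m < n\<close> q(1) by (cases n) auto
  moreover have "1 / q ^ m \<noteq> 1 / q ^ n"
  proof
    assume "1 / q ^ m = 1 / q ^ n"
    then have "q ^ (n - m) = 1"
      using q(1) \<open>m < n\<close> by (simp add: power_diff)
    then show False using q(2)[of "n - m"] \<open>m < n\<close> by simp
  qed
  ultimately show False by auto
qed

section \<open>Permuting the parameters\<close>

lemma ball_1_4: "(\<forall>i\<in>{1..4::nat}. P i) \<longleftrightarrow> P 1 \<and> P 2 \<and> P 3 \<and> P 4"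
proof -
  have "{1..4::nat} = {1, 2, 3, 4}" by auto
  then show ?thesis by simp
qed

lemma prod_1_4:
  fixes f :: "nat \<Rightarrow> 'a::comm_monoid_mult"
  shows "(\<Prod>i\<in>{1..4}. f i) = f 1 * f 2 * f 3 * f 4"
proof -
  have "{1..4::nat} = {1, 2, 3, 4}" by auto
  then show ?thesis by (simp add: mult.assoc)
qed

text \<open>In terms of quantifiers and a product over the index set, the condition can be reindexed
  by a permutation.\<close>

lemma AW_generic_iff:
  fixes a :: "nat \<Rightarrow> 'f::field_char_0"
  shows "AW_generic (a 1) (a 2) (a 3) (a 4) q \<longleftrightarrow>
    q \<noteq> 0 \<and> (\<forall>m\<ge>1. q ^ m \<noteq> 1) \<and> (\<forall>i\<in>{1..4}. a i \<noteq> 0) \<and>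
    (\<forall>i\<in>{1..4}. \<forall>j\<in>{1..4}. i \<noteq> j \<longrightarrow> (\<forall>m. a i * a j * q ^ m \<noteq> 1)) \<and>
    (\<forall>m. (\<Prod>i\<in>{1..4}. a i) * q ^ m \<noteq> 1)"
  unfolding AW_generic_def ball_1_4 prod_1_4 by (auto simp: mult_ac)

lemma AW_generic_permute:
  fixes a :: "nat \<Rightarrow> 'f::field_char_0"
  assumes gen: "AW_generic (a 1) (a 2) (a 3) (a 4) q" and \<pi>: "\<pi> permutes {1..4}"
  shows "AW_generic (a (\<pi> 1)) (a (\<pi> 2)) (a (\<pi> 3)) (a (\<pi> 4)) q"
proof -
  have "\<pi> i \<in> {1..4} \<longleftrightarrow> i \<in> {1..4}" "\<pi> i = \<pi> j \<longleftrightarrow> i = j" for i j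
    using \<pi> by (auto simp: permutes_in_image permutes_inj inj_eq simp del: atLeastAtMost_iff)
  moreover have "(\<Prod>i\<in>{1..4}. a (\<pi> i)) = (\<Prod>i\<in>{1..4}. a i)"
    using prod.permute[OF \<pi>, of a] by (simp add: o_def)
  ultimately show ?thesis
    using gen unfolding AW_generic_iff[of a] AW_generic_iff[of "\<lambda>i. a (\<pi> i)"]
    by (simp del: atLeastAtMost_iff)
qed

lemma AW_op_permute:
  fixes a :: "nat \<Rightarrow> 'f::field_char_0"
  assumes \<pi>: "\<pi> permutes {1..4}"
  shows "AW_op (a (\<pi> 1)) (a (\<pi> 2)) (a (\<pi> 3)) (a (\<pi> 4)) q = AW_op (a 1) (a 2) (a 3) (a 4) q"
proof -
  have "AW_weight (a (\<pi> 1)) (a (\<pi> 2)) (a (\<pi> 3)) (a (\<pi> 4)) q z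
      = AW_weight (a 1) (a 2) (a 3) (a 4) q z" for z
    using prod.permute[OF \<pi>, of "\<lambda>i. 1 - a i * z"] unfolding o_def prod_1_4 by (simp add: AW_weight_def)
  then show ?thesis
    by (intro ext) (simp add: AW_op_def)
qed

lemma AW_op_askey_wilson:
  assumes gen: "AW_generic a b c d q" and reg: "AW_regular q z"
  shows "AW_op a b c d q (\<lambda>z. poly (askey_wilson n a b c d q) ((z + inverse z) / 2)) z
       = AW_eigval (a * b * c * d) q n * poly (askey_wilson n a b c d q) ((z + inverse z) / 2)"
proof -
  have z: "z \<noteq> 0" and q: "q \<noteq> 0"
    using gen reg by (auto simp: AW_regular_def AW_generic_def)
  have "AW_op a b c d q (\<lambda>z. poly (askey_wilson n a b c d q) ((z + inverse z) / 2)) z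
      = AW_op a b c d q (askey_wilson_val n a b c d q) z"
    by (rule AW_op_cong) (simp_all add: poly_askey_wilson(1)[OF gen] q z)
  then show ?thesis
    by (simp add: AW_op_askey_wilson_val[OF gen reg] poly_askey_wilson(1)[OF gen z])
qed

text \<open>Both sides are monic of degree \<open>n\<close> and eigenpolynomials of the same
  operator for the same eigenvalue, because the weight and the product of the parameters are
  symmetric. Genericity of the permuted parameters comes from
  \<open>AW_generic_permute\<close>.\<close>

lemma askey_wilson_permute:
  fixes a :: "nat \<Rightarrow> 'f::field_char_0"
  assumes gen: "AW_generic (a 1) (a 2) (a 3) (a 4) q" and \<pi>: "\<pi> permutes {1..4}"
  shows "askey_wilson n (a (\<pi> 1)) (a (\<pi> 2)) (a (\<pi> 3)) (a (\<pi> 4)) q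
       = askey_wilson n (a 1) (a 2) (a 3) (a 4) q"
proof (rule AW_op_eigenpoly_unique[OF gen])
  note gen' = AW_generic_permute[OF gen \<pi>]
  have s: "a (\<pi> 1) * a (\<pi> 2) * a (\<pi> 3) * a (\<pi> 4) = a 1 * a 2 * a 3 * a 4"
    using prod.permute[OF \<pi>, of a] unfolding o_def prod_1_4 by simp
  fix R z
  assume "R \<in> {askey_wilson n (a (\<pi> 1)) (a (\<pi> 2)) (a (\<pi> 3)) (a (\<pi> 4)) q,
      askey_wilson n (a 1) (a 2) (a 3) (a 4) q}" and "AW_regular q z"
  then show "AW_op (a 1) (a 2) (a 3) (a 4) q (\<lambda>z. poly R ((z + inverse z) / 2)) z
      = AW_eigval (a 1 * a 2 * a 3 * a 4) q n * poly R ((z + inverse z) / 2)"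
    using AW_op_askey_wilson[OF gen] AW_op_askey_wilson[OF gen', unfolded AW_op_permute[OF \<pi>] s]
    by auto
qed (use poly_askey_wilson(2,3)[OF gen] poly_askey_wilson(2,3)[OF AW_generic_permute[OF gen \<pi>]]
      in simp_all)

theorem theorem6p11:
  fixes a :: "nat \<Rightarrow> 'f::field_char_0" and q ii :: 'f and n k :: nat and \<pi> :: "nat \<Rightarrow> nat"
  assumes "ii\<^sup>2 = -1" and "k \<le> n" and "\<pi> permutes {1..4}"
  shows "(AW_generic (ii * a 1) (ii * a 2) (ii * a 3) (ii * a 4) q \<longrightarrow>
            sigma_tilde_AW_H ii n k (a (\<pi> 1)) (a (\<pi> 2)) (a (\<pi> 3)) (a (\<pi> 4)) q =
            sigma_tilde_AW_H ii n k (a 1) (a 2) (a 3) (a 4) q) \<and>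
         (AW_generic (a 1) (a 2) (a 3) (a 4) q \<longrightarrow>
            sigma_AW_H n k (a (\<pi> 1)) (a (\<pi> 2)) (a (\<pi> 3)) (a (\<pi> 4)) q =
            sigma_AW_H n k (a 1) (a 2) (a 3) (a 4) q \<and>
            nu_AW_H n k (a (\<pi> 1)) (a (\<pi> 2)) (a (\<pi> 3)) (a (\<pi> 4)) q =
            nu_AW_H n k (a 1) (a 2) (a 3) (a 4) q)"
  \<comment> \<open>The connection coefficients depend on the parameters only through the
    polynomials p_m, for all m. The instance at \<open>ii * a i\<close> serves the rescaled moment,
    whose prefactor is free of the parameters.\<close>
  using askey_wilson_permute[of a q \<pi>] askey_wilson_permute[of "\<lambda>i. ii * a i" q \<pi>] assms(3)
  by (simp add: sigma_tilde_AW_H_def sigma_AW_H_def nu_AW_H_def)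

end
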